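(* Let $V$ be a finite set. Then the assignment $G\mapsto \mathbf{P}_G$ restricts to a bijection from the set $\mathbf{B}(V)$ of connected block graphs with vertex set $V$ onto the set $\mathbf{P}(V)$ of compatible families of $V$-partitions; equivalently, it induces a bijection from the set of block-equivalence classes of connected simple graphs with vertex set $V$ onto $\mathbf{P}(V)$. The inverse map is given by associating to each family $\mathbf{P}=(\mathbf{p}_v)_{v\in V}\in\mathbf{P}(V)$ the graph $B_{\mathbf{P}}:=(V,E_{\mathbf{P}})$ with $$E_{\mathbf{P}}:=\Big\{\{u,v\}\in\tbinom{V}{2}:\ \mathbf{p}_w[u]=\mathbf{p}_w[v]\text{ for all } w\in V-\{u,v\}\Big\}.$$ In particular: (a) for every connected simple graph $G=(V,E)$, the edge set $[E]$ of $[G]$ coincides with the set of all $2$-subsets $\{u,v\}$ of $V$ such that $G^{(w)}[u]=G^{(w)}[v]$ for all $w\in V-\{u,v\}$; and (b) for every $\mathbf{P}=(\mathbf{p}_v)_{v\in V}\in\mathbf{P}(V)$ one has $\pi_0(B_{\mathbf{P}}^{(v)})=\mathbf{p}_v$ for every $v\in V$.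
   Context: All graphs are finite simple graphs with vertex set a fixed finite set $V$ and edge set $E\subseteq\binom{V}{2}$. For a partition $\mathbf{p}$ of a set $Y$ and $y\in Y$, $\mathbf{p}[y]$ denotes the block of $\mathbf{p}$ containing $y$. For a graph $G=(V,E)$: $\pi_0(G)$ is the partition of $V$ into the vertex sets of the connected components of $G$; $G[v]:=\pi_0(G)[v]$; $G^{(v)}$ is the graph $(V,\{e\in E: v\notin e\})$ (all edges at $v$ removed, vertex set still $V$); and $\mathbf{P}_G:=(\pi_0(G^{(v)}))_{v\in V}$, a $V$-indexed family of partitions of $V$. A block graph is a graph in which every block (maximal 2-connected subgraph) is a clique. $[G]$ denotes the graph $(V,[E])$, where $[E]$ is the union of $E$ and all $2$-subsets $\{u,v\}$ of $V$ that are both contained in (the vertex set of) some circuit of $G$; this is the smallest block graph with vertex set $V$ containing $G$. Two graphs $G,G'$ on $V$ are block-equivalent if $[G]=[G']$. $\mathbf{B}(V)$ is the set of connected block graphs with vertex set $V$. A family $\mathbf{P}=(\mathbf{p}_v)_{v\in V}$ of partitions of $V$ is a compatible family of $V$-partitions if $\{v\}\in\mathbf{p}_v$ for all $v\in V$ and $\mathbf{p}_v[u]\cup\mathbf{p}_u[v]=V$ for any two distinct $u,v\in V$; $\mathbf{P}(V)$ denotes the set of all such families. *)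

theory Defs
  imports "HOL-Library.Ramsey" "HOL-Library.Disjoint_Sets" "HOL-Library.FuncSet"
begin

type_synonym 'a graph = "'a set \<times> 'a set set"

abbreviation verts :: "'a graph \<Rightarrow> 'a set" where
  "verts G \<equiv> fst G"

abbreviation edges :: "'a graph \<Rightarrow> 'a set set" where
  "edges G \<equiv> snd G"

definition simple_graph :: "'a graph \<Rightarrow> bool" where
  "simple_graph G \<longleftrightarrow> finite (verts G) \<and> edges G \<subseteq> [verts G]\<^bsup>2\<^esup>"

definition joined :: "'a graph \<Rightarrow> ('a \<times> 'a) set" where
  "joined G = {(u, v). u \<in> verts G \<and> v \<in> verts G \<and> (u, v) \<in> {(x, y). {x, y} \<in> edges G}\<^sup>*}"

text \<open>The graph without vertices counts as connected.\<close>

definition connected_graph :: "'a graph \<Rightarrow> bool" where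
  "connected_graph G \<longleftrightarrow> (\<forall>u\<in>verts G. \<forall>v\<in>verts G. (u, v) \<in> joined G)"

definition pi0 :: "'a graph \<Rightarrow> 'a set set" where
  "pi0 G = verts G // joined G"

text \<open>The block of the partition \<open>p\<close> that contains \<open>y\<close>.\<close>

definition part_of :: "'a set set \<Rightarrow> 'a \<Rightarrow> 'a set" where
  "part_of p y = (THE A. A \<in> p \<and> y \<in> A)"

definition comp_of :: "'a graph \<Rightarrow> 'a \<Rightarrow> 'a set" where
  "comp_of G v = part_of (pi0 G) v"

text \<open>The graph \<open>G\<^sup>(\<^sup>v\<^sup>)\<close>: the vertex \<open>v\<close> stays, as an isolated vertex.\<close>

definition isolate :: "'a graph \<Rightarrow> 'a \<Rightarrow> 'a graph" where
  "isolate G v = (verts G, {e \<in> edges G. v \<notin> e})"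

definition remove_vertex :: "'a graph \<Rightarrow> 'a \<Rightarrow> 'a graph" where
  "remove_vertex G v = (verts G - {v}, {e \<in> edges G. v \<notin> e})"

definition subgraph :: "'a graph \<Rightarrow> 'a graph \<Rightarrow> bool" where
  "subgraph H G \<longleftrightarrow> simple_graph H \<and> verts H \<subseteq> verts G \<and> edges H \<subseteq> edges G"

text \<open>
  As usual when speaking of blocks, the complete graphs on one and on two vertices
  count as 2-connected, so that bridges and isolated vertices form blocks.
\<close>

definition two_connected :: "'a graph \<Rightarrow> bool" where
  "two_connected G \<longleftrightarrow>
     verts G \<noteq> {} \<and> connected_graph G \<and> (\<forall>v\<in>verts G. connected_graph (remove_vertex G v))"

definition is_block :: "'a graph \<Rightarrow> 'a graph \<Rightarrow> bool" where
  "is_block G H \<longleftrightarrow> subgraph H G \<and> two_connected H \<and>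
     (\<forall>H'. subgraph H' G \<and> two_connected H' \<and> subgraph H H' \<longrightarrow> H' = H)"

definition is_clique :: "'a graph \<Rightarrow> bool" where
  "is_clique G \<longleftrightarrow> edges G = [verts G]\<^bsup>2\<^esup>"

definition block_graph :: "'a graph \<Rightarrow> bool" where
  "block_graph G \<longleftrightarrow> simple_graph G \<and> (\<forall>H. is_block G H \<longrightarrow> is_clique H)"

text \<open>A circuit is given by the list of its (distinct) vertices in cyclic order.\<close>

definition circuit :: "'a graph \<Rightarrow> 'a list \<Rightarrow> bool" where
  "circuit G c \<longleftrightarrow> 3 \<le> length c \<and> distinct c \<and>
     (\<forall>i<length c. {c ! i, c ! (Suc i mod length c)} \<in> edges G)"

text \<open>The graph \<open>[G] = (V, [E])\<close>.\<close>

definition block_closure :: "'a graph \<Rightarrow> 'a graph" where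
  "block_closure G =
     (verts G, edges G \<union> {e \<in> [verts G]\<^bsup>2\<^esup>. \<exists>c. circuit G c \<and> e \<subseteq> set c})"

definition connected_graphs :: "'a set \<Rightarrow> 'a graph set" where
  "connected_graphs V = {G. verts G = V \<and> simple_graph G \<and> connected_graph G}"

definition connected_block_graphs :: "'a set \<Rightarrow> 'a graph set" where
  "connected_block_graphs V = {G. verts G = V \<and> block_graph G \<and> connected_graph G}"

definition block_equiv :: "'a set \<Rightarrow> ('a graph \<times> 'a graph) set" where
  "block_equiv V = {(G, G'). G \<in> connected_graphs V \<and> G' \<in> connected_graphs V \<and>
     block_closure G = block_closure G'}"

text \<open>
  A \<open>V\<close>-indexed family is a function that is extensional on \<open>V\<close>, so that equality of
  families is equality of functions.
\<close>

definition graph_family :: "'a graph \<Rightarrow> 'a \<Rightarrow> 'a set set" where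
  "graph_family G = (\<lambda>v\<in>verts G. pi0 (isolate G v))"

definition compatible_families :: "'a set \<Rightarrow> ('a \<Rightarrow> 'a set set) set" where
  "compatible_families V = {P \<in> (\<Pi>\<^sub>E v\<in>V. {p. partition_on V p}).
     (\<forall>v\<in>V. {v} \<in> P v) \<and>
     (\<forall>u\<in>V. \<forall>v\<in>V. u \<noteq> v \<longrightarrow> part_of (P v) u \<union> part_of (P u) v = V)}"

definition family_graph :: "'a set \<Rightarrow> ('a \<Rightarrow> 'a set set) \<Rightarrow> 'a graph" where
  "family_graph V P =
     (V, {{u, v} | u v. {u, v} \<in> [V]\<^bsup>2\<^esup> \<and>
            (\<forall>w\<in>V - {u, v}. part_of (P w) u = part_of (P w) v)})"

text \<open>
  The map induced by \<open>G \<mapsto> graph_family G\<close> on a block-equivalence class; it is meaningful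
  when \<open>graph_family\<close> is constant on the class.
\<close>

definition class_family :: "'a graph set \<Rightarrow> 'a \<Rightarrow> 'a set set" where
  "class_family C = the_elem (graph_family ` C)"

end

theory Submission
  imports Defs
begin

text \<open>
  Edges of \<open>[G]\<close> are the pairs that no third vertex separates; this is Menger's theorem for two
  paths. Hence \<open>[G]\<close> can be read off \<open>\<^bold>P\<^sub>G\<close>. Conversely, for a compatible family call \<open>w\<close> a separator
  of \<open>a\<close> and \<open>b\<close> if \<open>\<^bold>p\<^sub>w\<close> puts them into different blocks. Compatibility makes the separators of
  \<open>a, w\<close> and of \<open>w, b\<close> proper subsets of those of \<open>a, b\<close>, so repeatedly inserting separators produces
  a path of \<open>B\<^sub>P\<close> from \<open>a\<close> to \<open>b\<close> all of whose inner vertices are separators of \<open>a\<close> and \<open>b\<close>.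
  This path avoids every \<open>v\<close> with \<open>\<^bold>p\<^sub>v[a] = \<^bold>p\<^sub>v[b]\<close>.
\<close>

section \<open>Paths and reachability avoiding a set of vertices\<close>

text \<open>For \<open>Z = {w}\<close> this is reachability in \<open>isolate G w\<close> and, away
  from \<open>w\<close>, also in \<open>remove_vertex G w\<close>, so one relation serves both
  components and 2-connectedness. Every point reaches itself, even a point of
  \<open>Z\<close>.\<close>

definition reach :: "'a set set \<Rightarrow> 'a set \<Rightarrow> ('a \<times> 'a) set" where
  "reach E Z = {(x, y). {x, y} \<in> E \<and> x \<notin> Z \<and> y \<notin> Z}\<^sup>*"

definition path :: "'a set set \<Rightarrow> 'a list \<Rightarrow> bool" where
  "path E p \<longleftrightarrow> p \<noteq> [] \<and> distinct p \<and> successively (\<lambda>x y. {x, y} \<in> E) p"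

lemma successively_edge_rev:
  assumes "successively (\<lambda>x y. {x, y} \<in> E) p"
  shows "successively (\<lambda>x y. {x, y} \<in> E) (rev p)"
  unfolding successively_rev by (rule successively_mono[OF assms]) (simp add: insert_commute)

lemma reach_refl [simp]: "(x, x) \<in> reach E Z"
  by (simp add: reach_def)

lemma reach_trans: "(x, y) \<in> reach E Z \<Longrightarrow> (y, z) \<in> reach E Z \<Longrightarrow> (x, z) \<in> reach E Z"
  unfolding reach_def by (rule rtrancl_trans)

lemma reach_edge: "{x, y} \<in> E \<Longrightarrow> x \<notin> Z \<Longrightarrow> y \<notin> Z \<Longrightarrow> (x, y) \<in> reach E Z"
  unfolding reach_def by (rule r_into_rtrancl) simp

lemma reach_sym: "(x, y) \<in> reach E Z \<Longrightarrow> (y, x) \<in> reach E Z"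
proof -
  have "sym {(x, y). {x, y} \<in> E \<and> x \<notin> Z \<and> y \<notin> Z}"
    by (auto simp: sym_def insert_commute)
  then show "(x, y) \<in> reach E Z \<Longrightarrow> (y, x) \<in> reach E Z"
    unfolding reach_def by (meson sym_rtrancl symD)
qed

lemma reach_mono: "E \<subseteq> F \<Longrightarrow> Y \<subseteq> Z \<Longrightarrow> reach E Z \<subseteq> reach F Y"
  unfolding reach_def by (rule rtrancl_mono) auto

lemma reach_from_avoided: "(x, y) \<in> reach E Z \<Longrightarrow> x \<in> Z \<Longrightarrow> y = x"
  unfolding reach_def by (erule converse_rtranclE) auto

text \<open>A walk is shortened while it is built from its end: if the new first vertex already lies
  on the path, only the part from that vertex on is kept.\<close>

lemma reach_imp_path:
  assumes "(a, b) \<in> reach E Z" "b \<notin> Z"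
  shows "\<exists>p. path E p \<and> hd p = a \<and> last p = b \<and> set p \<inter> Z = {}"
  using assms(1) unfolding reach_def
proof (induction rule: converse_rtrancl_induct)
  case base
  show ?case using assms(2) by (intro exI[of _ "[b]"]) (auto simp: path_def)
next
  case (step a y)
  then obtain p where p: "path E p" "hd p = y" "last p = b" "set p \<inter> Z = {}" by auto
  show ?case
  proof (cases "a \<in> set p")
    case True
    then obtain xs ys where "p = xs @ a # ys" by (auto dest: split_list)
    then show ?thesis using p
      by (intro exI[of _ "a # ys"]) (auto simp: path_def successively_append_iff)
  next
    case False
    then show ?thesis using p step(1)
      by (intro exI[of _ "a # p"]) (auto simp: path_def successively_Cons)
  qed
qed

text \<open>The edges used stay inside \<open>set p\<close>. This matters twice: a circuit has to be
  2-connected as a subgraph on its own vertices, and a path with one vertex cut off at its end has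
  to avoid that vertex.\<close>

lemma path_imp_reach:
  assumes "successively (\<lambda>x y. {x, y} \<in> E) p" "set p \<inter> Z = {}" "x \<in> set p" "y \<in> set p"
  shows "(x, y) \<in> reach (E \<inter> Pow (set p)) Z"
proof -
  have hd: "(hd q, z) \<in> reach (E \<inter> Pow (set q)) Z"
    if "successively (\<lambda>x y. {x, y} \<in> E) q" "set q \<inter> Z = {}" "z \<in> set q" for q z
    using that
  proof (induction q)
    case (Cons a q)
    show ?case
    proof (cases "z = a")
      case False
      with Cons.prems have q: "z \<in> set q" "q \<noteq> []" by auto
      then have "(hd q, z) \<in> reach (E \<inter> Pow (set q)) Z"
        using Cons by (auto simp: successively_Cons)
      then have qz: "(hd q, z) \<in> reach (E \<inter> Pow (set (a # q))) Z"
        using reach_mono[of "E \<inter> Pow (set q)" "E \<inter> Pow (set (a # q))" Z Z] by auto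
      have hdZ: "hd q \<notin> Z"
        using Cons.prems(2) hd_in_set[OF q(2)] by (metis IntI empty_iff list.set_intros(2))
      have "(a, hd q) \<in> reach (E \<inter> Pow (set (a # q))) Z"
        using Cons.prems q hdZ by (intro reach_edge) (auto simp: successively_Cons)
      from reach_trans[OF this qz] show ?thesis by simp
    qed simp
  qed simp
  show ?thesis
    using hd[OF assms(1,2,3)] hd[OF assms(1,2,4)] by (meson reach_sym reach_trans)
qed

lemma joined_iff: "(u, v) \<in> joined G \<longleftrightarrow> u \<in> verts G \<and> v \<in> verts G \<and> (u, v) \<in> reach (edges G) {}"
  by (simp add: joined_def reach_def)

lemma joined_isolate_iff:
  "(u, v) \<in> joined (isolate G w) \<longleftrightarrow> u \<in> verts G \<and> v \<in> verts G \<and> (u, v) \<in> reach (edges G) {w}"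
proof -
  have "{(x, y). {x, y} \<in> edges G \<and> w \<notin> {x, y}} = {(x, y). {x, y} \<in> edges G \<and> x \<notin> {w} \<and> y \<notin> {w}}"
    by auto
  then show ?thesis by (simp add: joined_def reach_def isolate_def)
qed

lemma connected_graph_iff:
  "connected_graph G \<longleftrightarrow> (\<forall>u\<in>verts G. \<forall>v\<in>verts G. (u, v) \<in> reach (edges G) {})"
  by (auto simp: connected_graph_def joined_iff)

lemma two_connected_iff:
  "two_connected H \<longleftrightarrow> verts H \<noteq> {} \<and> (\<forall>u\<in>verts H. \<forall>v\<in>verts H. (u, v) \<in> reach (edges H) {}) \<and>
     (\<forall>w\<in>verts H. \<forall>u\<in>verts H - {w}. \<forall>v\<in>verts H - {w}. (u, v) \<in> reach (edges H) {w})"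
proof -
  have "{(x, y). {x, y} \<in> edges H \<and> w \<notin> {x, y}} = {(x, y). {x, y} \<in> edges H \<and> x \<notin> {w} \<and> y \<notin> {w}}" for w
    by auto
  then have "connected_graph (remove_vertex H w) \<longleftrightarrow>
      (\<forall>u\<in>verts H - {w}. \<forall>v\<in>verts H - {w}. (u, v) \<in> reach (edges H) {w})" for w
    unfolding connected_graph_iff by (simp add: reach_def remove_vertex_def)
  then show ?thesis by (simp add: two_connected_def connected_graph_iff)
qed

section \<open>Circuits and separation\<close>

text \<open>Trades cyclic indices for a linear list with one closing edge, so that circuits can be
  cut and glued as lists.\<close>

lemma circuit_iff:
  "circuit G c \<longleftrightarrow> 3 \<le> length c \<and> distinct c \<and> successively (\<lambda>x y. {x, y} \<in> edges G) c \<and>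
     {last c, hd c} \<in> edges G"
proof (cases "c = []")
  case False
  have "(\<forall>i<length c. {c ! i, c ! (Suc i mod length c)} \<in> edges G) \<longleftrightarrow>
      (\<forall>i. Suc i < length c \<longrightarrow> {c ! i, c ! Suc i} \<in> edges G) \<and> {last c, hd c} \<in> edges G"
    (is "?L \<longleftrightarrow> ?R")
  proof
    assume L: ?L
    have "{c ! i, c ! Suc i} \<in> edges G" if "Suc i < length c" for i
      using L[rule_format, of i] that by simp
    moreover have "{last c, hd c} \<in> edges G"
      using L[rule_format, of "length c - 1"] False by (simp add: last_conv_nth hd_conv_nth)
    ultimately show ?R by blast
  next
    assume R: ?R
    show ?L
    proof (intro allI impI)
      fix i assume i: "i < length c"
      show "{c ! i, c ! (Suc i mod length c)} \<in> edges G"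
      proof (cases "Suc i < length c")
        case False
        with i have "i = length c - 1" "Suc i = length c" by auto
        then show ?thesis using R \<open>c \<noteq> []\<close> by (simp add: last_conv_nth hd_conv_nth)
      qed (use R in simp)
    qed
  qed
  then show ?thesis by (auto simp: circuit_def successively_conv_nth)
qed (simp add: circuit_def)

text \<open>Opening the circuit \<open>a @ w # b\<close> at \<open>w\<close> leaves the list
  \<open>b @ a\<close>, whose two halves are joined by the closing edge.\<close>

lemma circuit_minus_vertex:
  assumes "circuit G c"
  shows "\<exists>p. successively (\<lambda>x y. {x, y} \<in> edges G) p \<and> set p = set c - {w}"
proof (cases "w \<in> set c")
  case True
  then obtain a b where c: "c = a @ w # b" by (auto dest: split_list)
  then have "successively (\<lambda>x y. {x, y} \<in> edges G) (b @ a)"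
    using assms by (auto simp: circuit_iff successively_append_iff successively_Cons split: if_splits)
  moreover have "set (b @ a) = set c - {w}" using assms c by (auto simp: circuit_iff)
  ultimately show ?thesis by blast
qed (use assms in \<open>auto simp: circuit_iff\<close>)

lemma circuit_imp_reach:
  assumes "circuit G c" "x \<in> set c - {w}" "y \<in> set c - {w}"
  shows "(x, y) \<in> reach (edges G \<inter> Pow (set c)) {w}"
proof -
  obtain p where p: "successively (\<lambda>x y. {x, y} \<in> edges G) p" "set p = set c - {w}"
    using circuit_minus_vertex[OF assms(1)] by blast
  then have "(x, y) \<in> reach (edges G \<inter> Pow (set p)) {w}"
    using assms by (intro path_imp_reach) auto
  then show ?thesis
    using reach_mono[of "edges G \<inter> Pow (set p)" "edges G \<inter> Pow (set c)" "{w}" "{w}"] p(2) by auto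
qed

section \<open>Two internally disjoint paths (Menger's theorem)\<close>

definition linked :: "'a set set \<Rightarrow> 'a \<Rightarrow> 'a \<Rightarrow> bool" where
  "linked E u v \<longleftrightarrow> (\<exists>p q. path E p \<and> path E q \<and> hd p = u \<and> hd q = u \<and> last p = v \<and> last q = v \<and>
     set p \<inter> set q = {u, v})"

lemma linkedI:
  assumes "path E p" "path E q" "hd p = u" "hd q = u" "last p = v" "last q = v"
    "set p \<inter> set q = {u, v}"
  shows "linked E u v"
  unfolding linked_def using assms by (intro exI conjI)

text \<open>Prolonging both paths by the edge from \<open>w\<close> to \<open>v\<close> would make
  them share \<open>w\<close>. The path \<open>r\<close> from \<open>v\<close> back to
  \<open>u\<close> that avoids \<open>w\<close> supplies the second way to \<open>v\<close>.\<close>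

lemma linked_extend:
  assumes "linked E u w" "{w, v} \<in> E" "u \<noteq> w" "v \<noteq> u" "v \<noteq> w" "(v, u) \<in> reach E {w}"
  shows "linked E u v"
proof -
  obtain p q where pq: "path E p" "path E q" "hd p = u" "hd q = u" "last p = w" "last q = w"
     "set p \<inter> set q = {u, w}" using assms(1) by (auto simp: linked_def)
  obtain r where r: "path E r" "hd r = v" "last r = u" "w \<notin> set r"
    using reach_imp_path[OF assms(6)] assms(3) by auto
  \<comment> \<open>The end \<open>u\<close> of \<open>r\<close> is such a vertex, so a first one
    exists.\<close>
  have "\<exists>x\<in>set r. x \<in> set p \<union> set q"
    using r pq by (metis Un_iff last_in_set hd_in_set path_def)
  then obtain r1 x r2 where x: "r = r1 @ x # r2" "x \<in> set p \<union> set q" "\<forall>y\<in>set r1. y \<notin> set p \<union> set q"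
    using split_list_first_prop[of r "\<lambda>x. x \<in> set p \<union> set q"] by blast
  \<comment> \<open>The first vertex \<open>x\<close> of \<open>r\<close> on the two paths splits one of them; follow it up to \<open>x\<close> and then
    \<open>r\<close> backwards to \<open>v\<close>, and prolong the other one by the edge from \<open>w\<close> to \<open>v\<close>.\<close>
  have key: "linked E u v" if pq: "path E p" "path E q" "hd p = u" "hd q = u" "last p = w" "last q = w"
     "set p \<inter> set q = {u, w}" and xp: "x \<in> set p" and r1: "\<forall>y\<in>set r1. y \<notin> set p \<union> set q" for p q
  proof -
    obtain s t where p: "p = s @ x # t" using xp by (auto dest: split_list)
    \<comment> \<open>Since \<open>r\<close> avoids \<open>w\<close>, the vertex \<open>w\<close>
      comes strictly after \<open>x\<close> on \<open>p\<close>; cutting \<open>p\<close> at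
      \<open>x\<close> therefore removes \<open>w\<close>.\<close>
    have xw: "x \<noteq> w" using r x by auto
    then have "t \<noteq> []" using p pq by auto
    then have wt: "w \<in> set t" using p pq by (auto split: if_splits)
    have wsx: "w \<notin> set s" using wt p pq(1) by (auto simp: path_def)
    have vx: "if r1 = [] then v = x else hd r1 = v" using r x by (auto split: if_splits)
    \<comment> \<open>Needed for \<open>q @ [v]\<close> to be a path. Either \<open>v\<close> is
      \<open>x\<close> itself, which lies on \<open>p\<close> and is neither \<open>u\<close> nor
      \<open>w\<close>, or \<open>v\<close> comes before the first contact of \<open>r\<close> with
      the two paths.\<close>
    have vq: "v \<notin> set q"
    proof (cases "r1 = []")
      case True
      then show ?thesis using vx xp pq(7) assms by auto
    next
      case False
      then show ?thesis using vx r1 hd_in_set by fastforce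
    qed
    define p' where "p' = s @ x # rev r1"
    have "path E p'"
    proof -
      let ?adj = "\<lambda>x y. {x, y} \<in> E"
      have "successively ?adj (r1 @ [x])"
        using r(1) x(1) by (simp add: path_def successively_append_iff)
      then have "successively ?adj (rev (r1 @ [x]))"
        by (rule successively_edge_rev)
      moreover have "successively ?adj (s @ [x])"
        using pq(1) p by (simp add: path_def successively_append_iff)
      ultimately have "successively ?adj p'"
        by (simp add: p'_def successively_append_iff)
      moreover have "distinct p'"
        using pq(1) r(1) r1 p x(1) by (auto simp: p'_def path_def)
      ultimately show ?thesis by (simp add: path_def p'_def)
    qed
    moreover have "path E (q @ [v])"
      using pq assms vq by (auto simp: path_def successively_append_iff)
    moreover have "hd p' = u" using pq p by (cases s) (auto simp: p'_def)
    moreover have "hd (q @ [v]) = u" using pq by (auto simp: path_def)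
    moreover have lp': "last p' = v" using vx by (auto simp: p'_def last_rev split: if_splits)
    moreover have "last (q @ [v]) = v" by simp
    moreover have "set p' \<inter> set (q @ [v]) = {u, v}"
    proof -
      have "u \<in> set p'" "v \<in> set p'"
        using \<open>hd p' = u\<close> lp' hd_in_set[of p'] last_in_set[of p'] by (auto simp: p'_def)
      moreover have "u \<in> set q" using pq hd_in_set by (auto simp: path_def)
      moreover have "set p' \<inter> set q \<subseteq> {u}"
        using pq(7) r1 wsx xw p by (auto simp: p'_def)
      ultimately show ?thesis by auto
    qed
    ultimately show ?thesis by (rule linkedI)
  qed
  show ?thesis
  proof (cases "x \<in> set p")
    case True
    then show ?thesis using key[OF pq] x(3) by blast
  next
    case False
    \<comment> \<open>The same argument with \<open>p\<close> and \<open>q\<close>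
      exchanged.\<close>
    then show ?thesis using key[OF pq(2,1,4,3,6,5)] pq(7) x(2,3) by blast
  qed
qed

text \<open>Menger's theorem for two paths, by induction along one path from \<open>u\<close> to \<open>v\<close>.\<close>

lemma linked_if_not_separated:
  assumes "path E (u # p @ [v])" "\<And>w. w \<notin> {u, v} \<Longrightarrow> (u, v) \<in> reach E {w}"
  shows "linked E u v"
  using assms
proof (induction p arbitrary: v rule: rev_induct)
  case Nil
  then show ?case by (intro linkedI[of E "[u, v]" "[u, v]"]) auto
next
  case (snoc w p)
  have path: "path E (u # p @ [w])" and wv: "{w, v} \<in> E" "u \<noteq> w" "v \<noteq> u" "v \<noteq> w" "v \<notin> set p"
    using snoc.prems(1)
    by (auto simp: path_def successively_append_iff successively_Cons hd_append split: if_splits)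
  \<comment> \<open>The predecessor \<open>w\<close> of \<open>v\<close> inherits the hypothesis:
    the given path up to \<open>w\<close> avoids \<open>v\<close>, and for any other
    \<open>x\<close> one goes from \<open>u\<close> to \<open>v\<close> avoiding \<open>x\<close>
    and then back along the edge to \<open>w\<close>.\<close>
  have "(u, w) \<in> reach E {x}" if "x \<notin> {u, w}" for x
  proof (cases "x = v")
    case True
    have "(u, w) \<in> reach (E \<inter> Pow (set (u # p @ [w]))) {v}"
      using path wv by (intro path_imp_reach) (auto simp: path_def)
    then show ?thesis
      using reach_mono[of "E \<inter> Pow (set (u # p @ [w]))" E "{v}" "{v}"] True by auto
  next
    case False
    have "(v, w) \<in> reach E {x}" using wv False that by (intro reach_edge) (auto simp: insert_commute)
    moreover have "(u, v) \<in> reach E {x}" using snoc.prems(2) False that by blast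
    ultimately show ?thesis by (metis reach_trans)
  qed
  then have "linked E u w" by (rule snoc.IH[OF path])
  moreover have "(v, u) \<in> reach E {w}" by (rule reach_sym, rule snoc.prems(2)) (use wv in auto)
  ultimately show ?case by (rule linked_extend[OF _ wv(1-4)])
qed

text \<open>As \<open>u\<close> and \<open>v\<close> are not adjacent, neither path is a single
  edge. Following one path and returning along the other thus visits at least three
  vertices.\<close>

lemma linked_imp_circuit:
  assumes "linked (edges G) u v" "u \<noteq> v" "{u, v} \<notin> edges G"
  shows "\<exists>c. circuit G c \<and> {u, v} \<subseteq> set c"
proof -
  have split: "\<exists>a. p = u # a @ [v] \<and> a \<noteq> []" if "path (edges G) p" "hd p = u" "last p = v" for p
  proof (cases p)
    case (Cons x xs)
    then have "xs \<noteq> []" using that assms by auto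
    then have "xs = butlast xs @ [v]" using that Cons by (metis append_butlast_last_id last_ConsR)
    moreover have "butlast xs \<noteq> []"
    proof
      assume "butlast xs = []"
      with calculation have "p = [u, v]" using Cons that by simp
      then show False using that assms by (simp add: path_def)
    qed
    ultimately show ?thesis using Cons that by auto
  qed (use that in \<open>simp add: path_def\<close>)
  obtain p q where pq: "path (edges G) p" "path (edges G) q" "hd p = u" "hd q = u"
      "last p = v" "last q = v" and I: "set p \<inter> set q = {u, v}"
    using assms(1) by (auto simp: linked_def)
  obtain a b where a: "p = u # a @ [v]" "a \<noteq> []" and b: "q = u # b @ [v]"
    using split[OF pq(1,3,5)] split[OF pq(2,4,6)] by blast
  note p = pq(1)[unfolded a(1)] and q = pq(2)[unfolded b(1)] and I = I[unfolded a(1) b(1)]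
  have "set a \<inter> set b = {}" using I p by (auto simp: path_def)
  moreover have "successively (\<lambda>x y. {x, y} \<in> edges G) (rev (u # b @ [v]))"
    using q by (intro successively_edge_rev) (simp add: path_def)
  ultimately have "circuit G (u # a @ v # rev b)"
    using p q a(2) assms(2) unfolding circuit_iff path_def
    by (cases a) (auto simp: successively_append_iff successively_Cons hd_append)
  then show ?thesis by (intro exI[of _ "u # a @ v # rev b"]) auto
qed

text \<open>Deleting one vertex does not disconnect what is left of a circuit, which gives one
  direction. For the other, connectedness supplies a path along which the two-path form of Menger's
  theorem applies; its result is a circuit unless \<open>{u, v}\<close> is already an edge.\<close>

lemma edge_block_closure_iff:
  assumes "G \<in> connected_graphs V" "u \<in> V" "v \<in> V" "u \<noteq> v"
  shows "{u, v} \<in> edges (block_closure G) \<longleftrightarrow> (\<forall>w\<in>V - {u, v}. (u, v) \<in> reach (edges G) {w})"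
proof
  assume "{u, v} \<in> edges (block_closure G)"
  then consider "{u, v} \<in> edges G" | c where "circuit G c" "u \<in> set c" "v \<in> set c"
    by (auto simp: block_closure_def)
  then show "\<forall>w\<in>V - {u, v}. (u, v) \<in> reach (edges G) {w}"
  proof cases
    case 1
    then show ?thesis by (auto intro: reach_edge)
  next
    case 2
    then show ?thesis
      using circuit_imp_reach[OF 2(1)] subsetD[OF reach_mono[OF Int_lower1 subset_refl]] by fastforce
  qed
next
  assume sep: "\<forall>w\<in>V - {u, v}. (u, v) \<in> reach (edges G) {w}"
  have G: "verts G = V" "edges G \<subseteq> [V]\<^bsup>2\<^esup>" "(u, v) \<in> reach (edges G) {}"
    using assms by (auto simp: connected_graphs_def connected_graph_iff simple_graph_def)
  obtain p where p: "path (edges G) p" "hd p = u" "last p = v"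
    using reach_imp_path[OF G(3)] by auto
  have "p = u # butlast (tl p) @ [v]"
    using p assms(4) by (cases p) (auto simp: path_def split: if_splits)
  then have path: "path (edges G) (u # butlast (tl p) @ [v])" using p(1) by simp
  \<comment> \<open>A point outside \<open>V\<close> meets no edge, so avoiding it is no
    restriction.\<close>
  have "(u, v) \<in> reach (edges G) {w}" if "w \<notin> {u, v}" for w
  proof (cases "w \<in> V")
    case False
    then have "{(x, y). {x, y} \<in> edges G \<and> x \<notin> {} \<and> y \<notin> {}} = {(x, y). {x, y} \<in> edges G \<and> x \<notin> {w} \<and> y \<notin> {w}}"
      using G(2) by auto
    then show ?thesis using G(3) by (simp add: reach_def)
  qed (use sep that in auto)
  then have "linked (edges G) u v" by (rule linked_if_not_separated[OF path])
  then show "{u, v} \<in> edges (block_closure G)"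
    using linked_imp_circuit[of G u v] assms G by (auto simp: block_closure_def)
qed

section \<open>Partitions\<close>

lemma part_of_eq:
  assumes "partition_on V p" "A \<in> p" "y \<in> A"
  shows "part_of p y = A"
  unfolding part_of_def using assms
  by (intro the_equality) (auto simp: partition_on_def disjoint_def)

lemma part_of_mem:
  assumes "partition_on V p" "y \<in> V"
  shows "part_of p y \<in> p" "y \<in> part_of p y"
proof -
  obtain A where "A \<in> p" "y \<in> A" using assms by (auto simp: partition_on_def)
  then show "part_of p y \<in> p" "y \<in> part_of p y" using part_of_eq[OF assms(1)] by auto
qed

lemma part_of_eq_iff:
  assumes "partition_on V p" "x \<in> V" "y \<in> V"
  shows "part_of p x = part_of p y \<longleftrightarrow> x \<in> part_of p y"
  using part_of_mem[OF assms(1)] part_of_eq[OF assms(1)] assms by metis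

lemma equiv_joined: "equiv (verts G) (joined G)"
proof (rule equivI)
  show "joined G \<subseteq> verts G \<times> verts G" by (auto simp: joined_iff)
  show "refl_on (verts G) (joined G)" by (auto simp: refl_on_def joined_iff)
  show "sym (joined G)" unfolding sym_def joined_iff by (meson reach_sym)
  show "trans (joined G)" unfolding trans_def joined_iff by (meson reach_trans)
qed

lemma partition_on_pi0: "partition_on (verts G) (pi0 G)"
  unfolding pi0_def by (rule partition_on_quotient[OF equiv_joined])

lemma comp_of_eq: "u \<in> verts G \<Longrightarrow> comp_of G u = joined G `` {u}"
  unfolding comp_of_def
  by (rule part_of_eq[OF partition_on_pi0])
    (auto simp: pi0_def joined_iff intro: quotientI)

lemma verts_isolate [simp]: "verts (isolate G w) = verts G"
  by (simp add: isolate_def)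

lemma comp_of_isolate:
  "u \<in> verts G \<Longrightarrow> comp_of (isolate G w) u = {x \<in> verts G. (u, x) \<in> reach (edges G) {w}}"
  by (auto simp: comp_of_eq joined_isolate_iff)

lemma comp_of_isolate_eq_iff:
  assumes "u \<in> verts G" "v \<in> verts G"
  shows "comp_of (isolate G w) u = comp_of (isolate G w) v \<longleftrightarrow> (u, v) \<in> reach (edges G) {w}"
proof
  assume "comp_of (isolate G w) u = comp_of (isolate G w) v"
  then have "v \<in> comp_of (isolate G w) u" using assms by (simp add: comp_of_isolate)
  then show "(u, v) \<in> reach (edges G) {w}" using assms by (simp add: comp_of_isolate)
next
  assume "(u, v) \<in> reach (edges G) {w}"
  then have "(u, x) \<in> reach (edges G) {w} \<longleftrightarrow> (v, x) \<in> reach (edges G) {w}" for x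
    by (meson reach_sym reach_trans)
  then show "comp_of (isolate G w) u = comp_of (isolate G w) v"
    using assms by (simp add: comp_of_isolate)
qed

lemma part_of_graph_family:
  "w \<in> verts G \<Longrightarrow> part_of (graph_family G w) u = comp_of (isolate G w) u"
  by (simp add: graph_family_def comp_of_def)

section \<open>From graphs to families\<close>

text \<open>For the covering condition, follow a walk from \<open>u\<close> to \<open>x\<close>:
  after its last visit to \<open>{u, v}\<close> it starts at one of the two vertices and avoids the
  other. The singleton block is the isolated vertex.\<close>

lemma graph_family_compatible:
  assumes "G \<in> connected_graphs V"
  shows "graph_family G \<in> compatible_families V"
proof -
  have V: "verts G = V" and conn: "\<And>u v. u \<in> V \<Longrightarrow> v \<in> V \<Longrightarrow> (u, v) \<in> reach (edges G) {}"
    and E: "edges G \<subseteq> [V]\<^bsup>2\<^esup>"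
    using assms by (auto simp: connected_graphs_def connected_graph_iff simple_graph_def)
  have "graph_family G \<in> (\<Pi>\<^sub>E v\<in>V. {p. partition_on V p})"
    using partition_on_pi0[of "isolate G _"] V by (auto simp: graph_family_def)
  moreover have "{v} \<in> graph_family G v" if "v \<in> V" for v
  proof -
    have "comp_of (isolate G v) v = {v}"
      using that V by (auto simp: comp_of_isolate dest: reach_from_avoided)
    moreover have "comp_of (isolate G v) v \<in> pi0 (isolate G v)"
      using part_of_mem(1)[OF partition_on_pi0[of "isolate G v"], of v] that V by (simp add: comp_of_def)
    ultimately show ?thesis using that V by (simp add: graph_family_def)
  qed
  moreover have "part_of (graph_family G v) u \<union> part_of (graph_family G u) v = V"
    if uv: "u \<in> V" "v \<in> V" "u \<noteq> v" for u v
  proof -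
    have "(u, x) \<in> reach (edges G) {v} \<or> (v, x) \<in> reach (edges G) {u}" if "x \<in> V" for x
      using conn[OF uv(1) that] unfolding reach_def[of _ "{}"]
    proof (induction rule: rtrancl_induct)
      case (step y z)
      have yz: "(y, z) \<in> reach (edges G) {w}" if "y \<noteq> w" "z \<noteq> w" for w
        using step that by (intro reach_edge) auto
      \<comment> \<open>When the walk meets \<open>u\<close> or \<open>v\<close>, the claim restarts
        with the trivial walk there. Any other \<open>z\<close> is reached by one more edge, which
        avoids the same vertex as before.\<close>
      show ?case
      proof (cases "z = u \<or> z = v")
        case False
        from step.IH show ?thesis
        proof
          assume uy: "(u, y) \<in> reach (edges G) {v}"
          then have "y \<noteq> v" using reach_from_avoided[OF reach_sym[OF uy]] uv by auto
          then show ?thesis using uy yz[of v] False reach_trans by fast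
        next
          assume vy: "(v, y) \<in> reach (edges G) {u}"
          then have "y \<noteq> u" using reach_from_avoided[OF reach_sym[OF vy]] uv by auto
          then show ?thesis using vy yz[of u] False reach_trans by fast
        qed
      qed auto
    qed simp
    then show ?thesis using uv V by (auto simp: part_of_graph_family comp_of_isolate)
  qed
  ultimately show ?thesis by (auto simp: compatible_families_def)
qed

lemma edges_block_closure_eq:
  assumes "G \<in> connected_graphs V"
  shows "edges (block_closure G) = {{u, v} | u v. {u, v} \<in> [V]\<^bsup>2\<^esup> \<and>
           (\<forall>w\<in>V - {u, v}. comp_of (isolate G w) u = comp_of (isolate G w) v)}"
    (is "_ = ?R")
proof -
  have V: "verts G = V" and "edges G \<subseteq> [V]\<^bsup>2\<^esup>"
    using assms by (auto simp: connected_graphs_def simple_graph_def)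
  then have sub: "edges (block_closure G) \<subseteq> [V]\<^bsup>2\<^esup>"
    by (auto simp: block_closure_def)
  have iff: "{u, v} \<in> edges (block_closure G) \<longleftrightarrow>
      (\<forall>w\<in>V - {u, v}. comp_of (isolate G w) u = comp_of (isolate G w) v)"
    if "{u, v} \<in> [V]\<^bsup>2\<^esup>" for u v
    using that V edge_block_closure_iff[OF assms] by (simp add: comp_of_isolate_eq_iff)
  show ?thesis
  proof
    show "edges (block_closure G) \<subseteq> ?R"
    proof
      fix e assume e: "e \<in> edges (block_closure G)"
      then obtain u v where uv: "e = {u, v}" using sub by (meson nsets2_E subsetD)
      then show "e \<in> ?R" using iff e sub by blast
    qed
    show "?R \<subseteq> edges (block_closure G)" using iff by blast
  qed
qed

text \<open>Whether a third vertex separates a pair is visible in the components of the graphs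
  \<open>isolate G w\<close>, so \<open>[G]\<close> is determined by the family of \<open>G\<close>.
  All statements about inverses on the graph side rest on this.\<close>

lemma block_closure_eq_family_graph:
  assumes "G \<in> connected_graphs V"
  shows "block_closure G = family_graph V (graph_family G)"
proof (rule prod_eqI)
  have V: "verts G = V" using assms by (auto simp: connected_graphs_def)
  then show "verts (block_closure G) = verts (family_graph V (graph_family G))"
    by (simp add: block_closure_def family_graph_def)
  show "edges (block_closure G) = edges (family_graph V (graph_family G))"
    unfolding edges_block_closure_eq[OF assms] using V
    by (simp add: family_graph_def part_of_graph_family)
qed

section \<open>From families to graphs\<close>

text \<open>The defining condition is symmetric in \<open>u\<close> and \<open>v\<close>, so it does
  not depend on how the edge is written as a pair.\<close>

lemma edge_family_graph_iff:
  "{u, v} \<in> edges (family_graph V P) \<longleftrightarrow> u \<in> V \<and> v \<in> V \<and> u \<noteq> v \<and>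
     (\<forall>w\<in>V - {u, v}. part_of (P w) u = part_of (P w) v)"
proof
  assume "{u, v} \<in> edges (family_graph V P)"
  then obtain a b where "{u, v} = {a, b}" "a \<in> V" "b \<in> V" "a \<noteq> b"
    "\<forall>w\<in>V - {a, b}. part_of (P w) a = part_of (P w) b"
    by (auto simp: family_graph_def)
  then show "u \<in> V \<and> v \<in> V \<and> u \<noteq> v \<and> (\<forall>w\<in>V - {u, v}. part_of (P w) u = part_of (P w) v)"
    by (auto simp: doubleton_eq_iff)
qed (auto simp: family_graph_def)

section \<open>Separators in a compatible family\<close>

definition separators :: "'a set \<Rightarrow> ('a \<Rightarrow> 'a set set) \<Rightarrow> 'a \<Rightarrow> 'a \<Rightarrow> 'a set" where
  "separators V P a b = {w \<in> V - {a, b}. part_of (P w) a \<noteq> part_of (P w) b}"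

lemma separators_commute: "separators V P a b = separators V P b a"
  by (auto simp: separators_def)

text \<open>Let \<open>x\<close> separate \<open>a\<close> from \<open>w\<close>. Compatibility at
  \<open>x, w\<close> puts \<open>a\<close> into the block of \<open>x\<close> in
  \<open>P w\<close>; since \<open>w\<close> separates \<open>a\<close> from \<open>b\<close>, that
  block misses \<open>b\<close>. Compatibility again puts \<open>b\<close> into the block of
  \<open>w\<close> in \<open>P x\<close>, so \<open>x\<close> separates \<open>a\<close> from
  \<open>b\<close>. The inclusion is proper because of \<open>w\<close> itself.\<close>

lemma separators_psubset:
  assumes P: "P \<in> compatible_families V" and ab: "a \<in> V" "b \<in> V" and w: "w \<in> separators V P a b"
  shows "separators V P a w \<subset> separators V P a b"
proof -
  have part: "\<And>v. v \<in> V \<Longrightarrow> partition_on V (P v)" and sing: "\<And>v. v \<in> V \<Longrightarrow> {v} \<in> P v"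
    and comp: "\<And>u v. u \<in> V \<Longrightarrow> v \<in> V \<Longrightarrow> u \<noteq> v \<Longrightarrow> part_of (P v) u \<union> part_of (P u) v = V"
    using P by (auto simp: compatible_families_def)
  have wV: "w \<in> V" "w \<noteq> a" "w \<noteq> b" "part_of (P w) a \<noteq> part_of (P w) b"
    using w by (auto simp: separators_def)
  have "x \<in> separators V P a b" if "x \<in> separators V P a w" for x
  proof -
    have x: "x \<in> V" "x \<noteq> a" "x \<noteq> w" "part_of (P x) a \<noteq> part_of (P x) w"
      using that by (auto simp: separators_def)
    have "a \<notin> part_of (P x) w" using part_of_eq_iff[OF part] x wV ab by blast
    then have "a \<in> part_of (P w) x" using comp[of x w] x wV ab by blast
    then have "part_of (P w) a = part_of (P w) x" using part_of_eq_iff[OF part] x wV ab by blast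
    then have "b \<notin> part_of (P w) x" using part_of_eq_iff[OF part] x wV ab by metis
    then have b: "b \<in> part_of (P x) w" using comp[of x w] x wV ab by blast
    then have "part_of (P x) b = part_of (P x) w" using part_of_eq_iff[OF part] x wV ab by blast
    \<comment> \<open>Otherwise the block of \<open>w\<close> in \<open>P x\<close> would be the
      singleton \<open>{x}\<close>.\<close>
    moreover have "x \<noteq> b"
    proof
      assume "x = b"
      then have "part_of (P x) w = {x}"
        using calculation part_of_eq[OF part[OF x(1)] sing[OF x(1)]] by simp
      then show False using part_of_mem(2)[OF part[OF x(1)] wV(1)] x by auto
    qed
    ultimately show ?thesis using x by (auto simp: separators_def)
  qed
  moreover have "w \<notin> separators V P a w" by (simp add: separators_def)
  ultimately show ?thesis using w by blast
qed

text \<open>Induction on the number of separators: a separator \<open>w\<close> splits the task into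
  two with fewer separators, and with none left distinct \<open>a\<close> and \<open>b\<close> are
  adjacent. The set \<open>Z\<close> is kept general, since \<open>{}\<close> yields connectedness
  and \<open>{v}\<close> yields the blocks of \<open>P v\<close>.\<close>

lemma family_graph_reach:
  assumes "finite V" "P \<in> compatible_families V" "a \<in> V" "b \<in> V"
    "Z \<subseteq> V" "Z \<inter> ({a, b} \<union> separators V P a b) = {}"
  shows "(a, b) \<in> reach (edges (family_graph V P)) Z"
  using assms(3-6)
proof (induction "card (separators V P a b)" arbitrary: a b rule: less_induct)
  case less
  have fin: "finite (separators V P a b)" using assms(1) by (simp add: separators_def)
  show ?case
  proof (cases "a = b \<or> separators V P a b = {}")
    case True
    show ?thesis
    proof (cases "a = b")
      case False
      then have "{a, b} \<in> edges (family_graph V P)"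
        using True less.prems by (auto simp: edge_family_graph_iff separators_def)
      then show ?thesis using less.prems by (intro reach_edge) auto
    qed simp
  next
    case False
    then obtain w where w: "w \<in> separators V P a b" by blast
    then have wV: "w \<in> V" by (simp add: separators_def)
    have aw: "separators V P a w \<subset> separators V P a b"
      using separators_psubset[OF assms(2)] less.prems w by blast
    \<comment> \<open>\<open>separators_psubset\<close> keeps the first endpoint, so it is applied
      to \<open>b, a\<close> and turned around by symmetry.\<close>
    have bw: "separators V P w b \<subset> separators V P a b"
      using separators_psubset[OF assms(2), of b a w] less.prems w by (simp add: separators_commute)
    have "(a, w) \<in> reach (edges (family_graph V P)) Z"
      using less.hyps[OF psubset_card_mono[OF fin aw]] less.prems w wV aw by blast
    moreover have "(w, b) \<in> reach (edges (family_graph V P)) Z"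
      using less.hyps[OF psubset_card_mono[OF fin bw]] less.prems w wV bw by blast
    ultimately show ?thesis by (rule reach_trans)
  qed
qed

text \<open>An edge of \<open>family_graph V P\<close> that avoids \<open>v\<close> stays within one
  block of \<open>P v\<close> by definition. Conversely, if \<open>P v\<close> does not split
  \<open>a\<close> and \<open>b\<close>, then \<open>v\<close> is no separator; if \<open>v\<close>
  is one of them, the singleton block forces \<open>a = b\<close>.\<close>

lemma family_graph_reach_iff:
  assumes "finite V" "P \<in> compatible_families V" "a \<in> V" "b \<in> V" "v \<in> V"
  shows "(a, b) \<in> reach (edges (family_graph V P)) {v} \<longleftrightarrow> part_of (P v) a = part_of (P v) b"
proof
  assume "(a, b) \<in> reach (edges (family_graph V P)) {v}"
  then show "part_of (P v) a = part_of (P v) b"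
    unfolding reach_def
  proof (induction rule: rtrancl_induct)
    case (step y z)
    then show ?case using assms(5) by (auto simp: edge_family_graph_iff)
  qed simp
next
  assume eq: "part_of (P v) a = part_of (P v) b"
  have part: "partition_on V (P v)" "{v} \<in> P v"
    using assms by (auto simp: compatible_families_def)
  show "(a, b) \<in> reach (edges (family_graph V P)) {v}"
  proof (cases "v \<in> {a, b}")
    case True
    have "part_of (P v) v = {v}" using part_of_eq[OF part] by simp
    then have "a = b" using True eq part_of_mem(2)[OF part(1)] assms(3,4) by (metis insertE singletonD)
    then show ?thesis by simp
  next
    case False
    then show ?thesis using assms eq by (intro family_graph_reach) (auto simp: separators_def)
  qed
qed

text \<open>It suffices to compare equivalence relations, because a partition is the quotient by the
  relation of lying in a common block.\<close>

lemma pi0_isolate_family_graph: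
  assumes "finite V" "P \<in> compatible_families V" "v \<in> V"
  shows "pi0 (isolate (family_graph V P) v) = P v"
proof -
  have part: "partition_on V (P v)" using assms by (auto simp: compatible_families_def)
  have verts: "verts (family_graph V P) = V" by (simp add: family_graph_def)
  have "joined (isolate (family_graph V P) v) = {(x, y). \<exists>A\<in>P v. x \<in> A \<and> y \<in> A}"
  proof (intro set_eqI, clarify)
    fix x y
    have "(x, y) \<in> joined (isolate (family_graph V P) v) \<longleftrightarrow>
        x \<in> V \<and> y \<in> V \<and> part_of (P v) x = part_of (P v) y"
      using family_graph_reach_iff[OF assms(1,2) _ _ assms(3)] verts by (auto simp: joined_isolate_iff)
    also have "\<dots> \<longleftrightarrow> (\<exists>A\<in>P v. x \<in> A \<and> y \<in> A)"
      using part_of_mem[OF part] part_of_eq[OF part] partition_onD1[OF part] by (metis UnionI)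
    finally show "(x, y) \<in> joined (isolate (family_graph V P) v) \<longleftrightarrow>
        (x, y) \<in> {(x, y). \<exists>A\<in>P v. x \<in> A \<and> y \<in> A}" by simp
  qed
  then show ?thesis
    using partition_on_eq_quotient[OF part] verts by (simp add: pi0_def)
qed

lemma graph_family_family_graph:
  assumes "finite V" "P \<in> compatible_families V"
  shows "graph_family (family_graph V P) = P"
proof
  fix v
  have verts: "verts (family_graph V P) = V" by (simp add: family_graph_def)
  show "graph_family (family_graph V P) v = P v"
  proof (cases "v \<in> V")
    case True
    then show ?thesis
      using pi0_isolate_family_graph[OF assms] verts by (simp add: graph_family_def)
  next
    case False
    \<comment> \<open>Outside \<open>V\<close> both families take the value
      \<open>undefined\<close>.\<close>
    then show ?thesis using assms(2) verts
      by (auto simp: graph_family_def compatible_families_def PiE_def extensional_def)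
  qed
qed

lemma family_graph_connected:
  assumes "finite V" "P \<in> compatible_families V"
  shows "family_graph V P \<in> connected_graphs V"
  using assms family_graph_reach[OF assms, of _ _ "{}"]
  by (auto simp: connected_graphs_def connected_graph_iff simple_graph_def family_graph_def)

section \<open>The graph of a compatible family is a block graph\<close>

lemma two_connected_reach:
  assumes "two_connected H" "u \<in> verts H" "v \<in> verts H" "w \<notin> {u, v}" "edges H \<subseteq> [verts H]\<^bsup>2\<^esup>"
  shows "(u, v) \<in> reach (edges H) {w}"
proof (cases "w \<in> verts H")
  case False
  then have "{(x, y). {x, y} \<in> edges H \<and> x \<notin> {} \<and> y \<notin> {}} = {(x, y). {x, y} \<in> edges H \<and> x \<notin> {w} \<and> y \<notin> {w}}"
    using assms(5) by auto
  moreover have "(u, v) \<in> reach (edges H) {}" using assms by (auto simp: two_connected_iff)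
  ultimately show ?thesis by (simp add: reach_def)
qed (use assms in \<open>auto simp: two_connected_iff\<close>)

text \<open>No vertex separates two vertices of a block \<open>H\<close>, so any two of them are
  adjacent in \<open>family_graph V P\<close>. The complete graph \<open>K\<close> on the vertices
  of \<open>H\<close> is then a 2-connected subgraph containing \<open>H\<close>, and maximality
  gives \<open>K = H\<close>.\<close>

lemma family_graph_block_graph:
  assumes "finite V" "P \<in> compatible_families V"
  shows "family_graph V P \<in> connected_block_graphs V"
proof -
  let ?B = "family_graph V P"
  have B: "verts ?B = V" "simple_graph ?B" "connected_graph ?B"
    using family_graph_connected[OF assms] by (auto simp: connected_graphs_def)
  have "is_clique H" if "is_block ?B H" for H
  proof -
    have H: "subgraph H ?B" "two_connected H"
      and max: "\<And>H'. subgraph H' ?B \<Longrightarrow> two_connected H' \<Longrightarrow> subgraph H H' \<Longrightarrow> H' = H"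
      using that by (auto simp: is_block_def)
    have HE: "edges H \<subseteq> [verts H]\<^bsup>2\<^esup>" "finite (verts H)" "verts H \<subseteq> V" "edges H \<subseteq> edges ?B"
      using H(1) B by (auto simp: subgraph_def simple_graph_def)
    define K where "K = (verts H, [verts H]\<^bsup>2\<^esup>)"
    have "{u, v} \<in> edges ?B" if uv: "u \<in> verts H" "v \<in> verts H" "u \<noteq> v" for u v
    proof -
      have "part_of (P w) u = part_of (P w) v" if "w \<in> V - {u, v}" for w
      proof -
        have "(u, v) \<in> reach (edges H) {w}"
          using two_connected_reach[OF H(2) uv(1,2) _ HE(1)] that by blast
        then have "(u, v) \<in> reach (edges ?B) {w}" using reach_mono[OF HE(4)] by blast
        then show ?thesis using family_graph_reach_iff[OF assms] that uv HE by blast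
      qed
      then show ?thesis using uv HE by (auto simp: edge_family_graph_iff)
    qed
    then have "subgraph K ?B"
      using HE B by (auto simp: subgraph_def K_def simple_graph_def elim!: nsets2_E)
    moreover have "two_connected K"
      using H(2) reach_mono[OF HE(1)] unfolding two_connected_iff K_def by (simp, blast)
    moreover have "subgraph H K" using HE by (auto simp: subgraph_def K_def simple_graph_def)
    ultimately have "K = H" using max by blast
    then show ?thesis unfolding is_clique_def K_def by (metis snd_conv)
  qed
  then show ?thesis using B by (auto simp: connected_block_graphs_def block_graph_def)
qed

section \<open>Block graphs are closed\<close>

text \<open>Among the 2-connected subgraphs containing \<open>H\<close>, take one with the largest
  number of vertices plus edges. Any larger 2-connected subgraph also contains \<open>H\<close>,
  hence has the same counts and is equal to it.\<close>

lemma two_connected_in_block: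
  assumes "simple_graph G" "subgraph H G" "two_connected H"
  shows "\<exists>K. is_block G K \<and> subgraph H K"
proof -
  have fin: "finite (verts G)" "finite (edges G)"
    using assms(1) by (auto simp: simple_graph_def finite_imp_finite_nsets intro: finite_subset)
  let ?Q = "\<lambda>K. subgraph K G \<and> two_connected K \<and> subgraph H K"
  let ?m = "\<lambda>K :: 'a graph. card (verts K) + card (edges K)"
  have "?m K < Suc (?m G)" if "?Q K" for K
    using that fin by (auto simp: subgraph_def less_Suc_eq_le intro!: add_mono card_mono)
  moreover have "?Q H" using assms by (auto simp: subgraph_def)
  ultimately obtain K where K: "?Q K" and max: "\<And>L. ?Q L \<Longrightarrow> ?m L \<le> ?m K"
    using ex_has_greatest_nat[of ?Q H ?m "Suc (?m G)"] by blast
  have "L = K" if L: "subgraph L G" "two_connected L" "subgraph K L" for L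
  proof -
    have le: "verts K \<subseteq> verts L" "edges K \<subseteq> edges L" using L by (auto simp: subgraph_def)
    have finL: "finite (verts L)" "finite (edges L)"
      using L(1) fin by (auto simp: subgraph_def intro: finite_subset)
    have "?Q L" using L K by (auto simp: subgraph_def)
    then have "?m L \<le> ?m K" by (rule max)
    moreover have "card (verts K) \<le> card (verts L)" "card (edges K) \<le> card (edges L)"
      using le finL by (auto intro: card_mono)
    ultimately have "card (verts K) = card (verts L)" "card (edges K) = card (edges L)" by auto
    then show ?thesis using card_subset_eq le finL by (metis prod_eqI)
  qed
  then show ?thesis using K unfolding is_block_def by blast
qed

text \<open>A circuit spans a 2-connected subgraph. This lies in a block, which is a clique, so any
  two vertices of the circuit are already adjacent.\<close>

lemma block_closure_block_graph:
  assumes "block_graph G"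
  shows "block_closure G = G"
proof -
  have G: "simple_graph G" "edges G \<subseteq> [verts G]\<^bsup>2\<^esup>" "finite (verts G)"
    using assms by (auto simp: block_graph_def simple_graph_def)
  have "e \<in> edges G" if e: "e \<in> [verts G]\<^bsup>2\<^esup>" and c: "circuit G c" "e \<subseteq> set c" for e c
  proof -
    define H where "H = (set c, edges G \<inter> Pow (set c))"
    have cV: "set c \<subseteq> verts G"
    proof
      fix x assume "x \<in> set c"
      then obtain i where "i < length c" "x = c ! i" by (auto simp: in_set_conv_nth)
      then have "{x, c ! (Suc i mod length c)} \<in> edges G" using c by (auto simp: circuit_def)
      then show "x \<in> verts G" using G by auto
    qed
    have "edges G \<inter> Pow (set c) \<subseteq> [set c]\<^bsup>2\<^esup>" using G(2) by (auto simp: nsets_def)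
    then have "subgraph H G" using cV by (auto simp: H_def subgraph_def simple_graph_def)
    moreover have "two_connected H"
    proof -
      have "set c \<noteq> {}" using c by (auto simp: circuit_def)
      moreover have "(u, v) \<in> reach (edges G \<inter> Pow (set c)) {}" if "u \<in> set c" "v \<in> set c" for u v
        using that c by (intro path_imp_reach) (auto simp: circuit_iff)
      ultimately show ?thesis
        using circuit_imp_reach[OF c(1)] by (auto simp: two_connected_iff H_def)
    qed
    ultimately obtain K where K: "is_block G K" "subgraph H K"
      using two_connected_in_block[OF G(1)] by blast
    then have "edges K = [verts K]\<^bsup>2\<^esup>" using assms by (auto simp: block_graph_def is_clique_def)
    moreover have "e \<in> [verts K]\<^bsup>2\<^esup>"
      using e c K(2) by (auto simp: nsets_def subgraph_def H_def)
    ultimately show ?thesis using K(1) by (auto simp: is_block_def subgraph_def)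
  qed
  then show ?thesis by (auto simp: block_closure_def intro!: prod_eqI)
qed

section \<open>The correspondence\<close>

lemma connected_block_graphs_subset: "connected_block_graphs V \<subseteq> connected_graphs V"
  by (auto simp: connected_block_graphs_def connected_graphs_def block_graph_def)

lemma family_graph_graph_family:
  assumes "G \<in> connected_block_graphs V"
  shows "family_graph V (graph_family G) = G"
  using assms block_closure_eq_family_graph[of G V] block_closure_block_graph[of G]
    connected_block_graphs_subset[of V]
  by (auto simp: connected_block_graphs_def)

text \<open>The family of \<open>G\<close> can be recovered from \<open>[G]\<close>: as
  \<open>[G]\<close> is the graph of that family, its own family is the same one.\<close>

lemma graph_family_respects_block_equiv:
  assumes "finite V"
  shows "graph_family respects block_equiv V"
proof (rule congruentI)
  fix G G' assume "(G, G') \<in> block_equiv V"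
  then have G: "G \<in> connected_graphs V" "G' \<in> connected_graphs V" "block_closure G = block_closure G'"
    by (auto simp: block_equiv_def)
  have "graph_family (block_closure H) = graph_family H" if "H \<in> connected_graphs V" for H
    using graph_family_family_graph[OF assms graph_family_compatible[OF that]]
      block_closure_eq_family_graph[OF that] by simp
  then show "graph_family G = graph_family G'" using G by metis
qed

section \<open>Block-equivalence classes\<close>

lemma equiv_block_equiv: "equiv (connected_graphs V) (block_equiv V)"
  by (rule equivI) (auto simp: block_equiv_def refl_on_def sym_def trans_def)

text \<open>\<open>graph_family\<close> is constant on the class, so its image is a singleton and
  \<open>the_elem\<close> returns the intended value.\<close>

lemma class_family_class:
  assumes "finite V" "G \<in> connected_graphs V"
  shows "class_family (block_equiv V `` {G}) = graph_family G"
proof -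
  have "graph_family ` (block_equiv V `` {G}) = {graph_family G}"
  proof -
    have "graph_family H = graph_family G" if "H \<in> block_equiv V `` {G}" for H
      using that congruentD[OF graph_family_respects_block_equiv[OF assms(1)], of G H] by simp
    then show ?thesis using equiv_class_self[OF equiv_block_equiv assms(2)] by blast
  qed
  then show ?thesis by (simp add: class_family_def)
qed

text \<open>The graph of the family of \<open>G\<close> is \<open>[G]\<close>, a block graph and
  hence its own closure; it is a canonical representative of the class of \<open>G\<close>.\<close>

lemma block_equiv_family_graph:
  assumes "finite V" "G \<in> connected_graphs V"
  shows "block_equiv V `` {family_graph V (graph_family G)} = block_equiv V `` {G}"
proof -
  have F: "family_graph V (graph_family G) \<in> connected_block_graphs V"
    by (rule family_graph_block_graph[OF assms(1) graph_family_compatible[OF assms(2)]])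
  then have "block_closure (family_graph V (graph_family G)) = family_graph V (graph_family G)"
    by (intro block_closure_block_graph) (simp add: connected_block_graphs_def)
  then have "(family_graph V (graph_family G), G) \<in> block_equiv V"
    using assms F connected_block_graphs_subset block_closure_eq_family_graph[OF assms(2)]
    by (auto simp: block_equiv_def)
  then show ?thesis by (rule equiv_class_eq[OF equiv_block_equiv])
qed

theorem mainTheorem1:
  fixes V :: "'a set"
  assumes "finite V"
  shows "bij_betw graph_family (connected_block_graphs V) (compatible_families V)
    \<and> (graph_family respects block_equiv V
       \<and> bij_betw class_family (connected_graphs V // block_equiv V) (compatible_families V))
    \<and> (\<forall>P\<in>compatible_families V.
         family_graph V P \<in> connected_block_graphs V \<and> graph_family (family_graph V P) = P)
    \<and> (\<forall>G\<in>connected_block_graphs V. family_graph V (graph_family G) = G)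
    \<and> (\<forall>P\<in>compatible_families V. 
         family_graph V P \<in> connected_graphs V
         \<and> class_family (block_equiv V `` {family_graph V P}) = P)
    \<and> (\<forall>G\<in>connected_graphs V.
         edges (block_closure G) =
           {{u, v} | u v. {u, v} \<in> [V]\<^bsup>2\<^esup> \<and>
              (\<forall>w\<in>V - {u, v}. comp_of (isolate G w) u = comp_of (isolate G w) v)})
    \<and> (\<forall>P\<in>compatible_families V. \<forall>v\<in>V. pi0 (isolate (family_graph V P) v) = P v)"
proof (intro conjI ballI)
  show "bij_betw graph_family (connected_block_graphs V) (compatible_families V)"
    by (rule bij_betw_byWitness[of _ "family_graph V"])
      (use assms connected_block_graphs_subset in
        \<open>auto simp: family_graph_graph_family graph_family_family_graph
          intro!: graph_family_compatible family_graph_block_graph\<close>)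
  show "graph_family respects block_equiv V"
    by (rule graph_family_respects_block_equiv[OF assms])
  show class_eq: "class_family (block_equiv V `` {family_graph V P}) = P"
    if "P \<in> compatible_families V" for P
    using class_family_class[OF assms] family_graph_connected[OF assms that]
      graph_family_family_graph[OF assms that] by simp
  show "bij_betw class_family (connected_graphs V // block_equiv V) (compatible_families V)"
  \<comment> \<open>The inverse sends a family to the class of its graph.\<close>
  proof (rule bij_betw_byWitness[of _ "\<lambda>P. block_equiv V `` {family_graph V P}"])
    show "\<forall>C\<in>connected_graphs V // block_equiv V. block_equiv V `` {family_graph V (class_family C)} = C"
    proof
      fix C assume "C \<in> connected_graphs V // block_equiv V"
      then obtain G where "G \<in> connected_graphs V" "C = block_equiv V `` {G}" by (rule quotientE)
      then show "block_equiv V `` {family_graph V (class_family C)} = C"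
        using class_family_class[OF assms] block_equiv_family_graph[OF assms] by simp
    qed
    show "class_family ` (connected_graphs V // block_equiv V) \<subseteq> compatible_families V"
      using assms by (auto simp: class_family_class graph_family_compatible elim!: quotientE)
    show "(\<lambda>P. block_equiv V `` {family_graph V P}) ` compatible_families V \<subseteq> connected_graphs V // block_equiv V"
      using assms by (auto intro!: quotientI family_graph_connected)
  qed (use class_eq in blast)
qed (use assms in \<open>simp_all add: family_graph_block_graph graph_family_family_graph
      family_graph_graph_family family_graph_connected edges_block_closure_eq pi0_isolate_family_graph\<close>)

end
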